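(* Let $Y$ be a real random variable whose moment generating function $E[e^{tY}]$ exists for $|t|<r$, for some $r>0$. Then the generating function of the probabilistic Lah-Bell polynomials associated with $Y$ is given by $$\exp\left(x\left(E\left[\left(\frac{1}{1-t}\right)^{Y}\right]-1\right)\right)=\sum_{n=0}^{\infty}B_{n}^{(L,Y)}(x)\frac{t^{n}}{n!},$$ that is, for every real $x$ the identity holds for all $t$ in some neighborhood of $0$.
   Context: The probabilistic Lah numbers $L_Y(n,k)$ ($n\ge k\ge 0$) associated with $Y$ are defined by the power series expansion about $t=0$ $$\frac{1}{k!}\left(E\left[\left(\frac{1}{1-t}\right)^{Y}\right]-1\right)^{k}=\sum_{n=k}^{\infty}L_{Y}(n,k)\frac{t^{n}}{n!},\quad k\ge 0.$$ The probabilistic Lah-Bell polynomials associated with $Y$ are $B_{n}^{(L,Y)}(x)=\sum_{k=0}^{n}L_{Y}(n,k)x^{k}$, $n\ge 0$. *)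

theory Defs
  imports "HOL-Probability.Probability"
begin

definition lah_gen :: "'a measure \<Rightarrow> ('a \<Rightarrow> real) \<Rightarrow> real \<Rightarrow> real"
  where "lah_gen M Y t = (\<integral>\<omega>. (1 / (1 - t)) powr (Y \<omega>) \<partial>M)"

text \<open>
  Near \<open>t = 0\<close> the expectation is that of an integrable function, so the convention that the
  Bochner integral of a non-integrable function is \<open>0\<close> plays no role.
\<close>

lemma lah_gen_integrable:
  fixes Y :: "'a \<Rightarrow> real" and r :: real
  assumes "r > 0"
    and "\<And>t. \<bar>t\<bar> < r \<Longrightarrow> integrable M (\<lambda>\<omega>. exp (t * Y \<omega>))"
  shows "\<forall>\<^sub>F t in nhds 0. integrable M (\<lambda>\<omega>. (1 / (1 - t)) powr (Y \<omega>))"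
proof -
  have "((\<lambda>t::real. \<bar>ln (1 / (1 - t))\<bar>) \<longlongrightarrow> \<bar>ln (1 / (1 - 0))\<bar>) (nhds 0)"
    by (intro tendsto_intros filterlim_ident) auto
  then have "\<forall>\<^sub>F t::real in nhds 0. \<bar>ln (1 / (1 - t))\<bar> < r"
    using assms(1) by (intro order_tendstoD) auto
  moreover have "\<forall>\<^sub>F t::real in nhds 0. t < 1"
    using order_tendstoD(2)[OF filterlim_ident, of "0::real" 1] by simp
  ultimately show ?thesis
  proof eventually_elim
    case (elim t)
    then have "1 / (1 - t) \<noteq> 0" by simp
    then have "(\<lambda>\<omega>. (1 / (1 - t)) powr (Y \<omega>)) = (\<lambda>\<omega>. exp (ln (1 / (1 - t)) * Y \<omega>))"
      by (simp add: powr_def mult.commute)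
    with assms(2)[OF elim(1)] show ?case by simp
  qed
qed

text \<open>
  The number \<open>L\<^sub>Y(n,k)\<close> is \<open>n!\<close> times the \<open>n\<close>-th coefficient of the power series expansion about
  \<open>0\<close> of \<open>(E[(1/(1-t))\<^sup>Y] - 1)\<^sup>k / k!\<close>. Coefficients with \<open>n < k\<close> vanish, since the base is \<open>0\<close> at
  \<open>t = 0\<close>.
\<close>

definition prob_lah :: "'a measure \<Rightarrow> ('a \<Rightarrow> real) \<Rightarrow> nat \<Rightarrow> nat \<Rightarrow> real"
  where "prob_lah M Y n k =
    fact n * fps_nth (THE F. (\<lambda>t. 1 / fact k * (lah_gen M Y t - 1) ^ k) has_fps_expansion F) n"

definition prob_lah_bell :: "'a measure \<Rightarrow> ('a \<Rightarrow> real) \<Rightarrow> nat \<Rightarrow> real \<Rightarrow> real"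
  where "prob_lah_bell M Y n x = (\<Sum>k=0..n. prob_lah M Y n k * x ^ k)"

end

theory Submission
  imports Defs "HOL-Complex_Analysis.Laurent_Convergence"
begin

text \<open>
  The binomial series gives \<open>(1/(1-t))\<^sup>Y\<close> as a power series in \<open>t\<close> whose coefficients are the
  rising factorials of \<open>Y\<close> over \<open>n!\<close>. Its partial sums are dominated by \<open>(1/(1-\<bar>t\<bar>))\<^bsup>\<bar>Y\<bar>\<^esup>\<close>, which
  is integrable for small \<open>t\<close>, so the series may be integrated term by term. The expansion of
  \<open>exp (x (E[(1/(1-t))\<^sup>Y] - 1))\<close> is then a composition of power series, and its \<open>n\<close>-th coefficient
  is \<open>B\<^sub>n(x) / n!\<close> by uniqueness of expansions. Composition is available for complex series and
  descends to real ones by extending scalars.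
\<close>

lemma has_fps_expansion_unique:
  fixes F G :: "'a :: {banach, real_normed_field} fps"
  assumes "f has_fps_expansion F" "f has_fps_expansion G"
  shows "F = G"
proof -
  define D where "D = F - G"
  define c where "c = fps_nth D (subdegree D)"
  have "(\<lambda>_. 0) has_fps_expansion D"
    using has_fps_expansion_diff[OF assms] by (simp add: D_def)
  from has_fps_expansion_shift[OF this order_refl c_def]
  have "(\<lambda>x. if x = 0 then c else 0) has_fps_expansion fps_shift (subdegree D) D"
    by (simp only: div_0)
  from has_fps_expansion_imp_continuous[OF this, of UNIV]
  have "((\<lambda>x::'a. if x = 0 then c else 0) \<longlongrightarrow> c) (at 0)"
    by (simp add: continuous_within)
  moreover have "((\<lambda>x::'a. if x = 0 then c else 0) \<longlongrightarrow> 0) (at 0)"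
    by (rule tendsto_eventually) (simp add: eventually_at_filter)
  ultimately have "c = 0"
    by (rule tendsto_unique[OF at_neq_bot])
  then have "D = 0"
    by (simp add: c_def)
  then show ?thesis
    by (simp add: D_def)
qed

lemma has_fps_expansion_imp_eventually_in_eball:
  assumes "f has_fps_expansion F"
  shows "\<forall>\<^sub>F t in nhds 0. t \<in> eball 0 (fps_conv_radius F)"
  using assms by (intro eventually_nhds_in_open) (auto simp: has_fps_expansion_def zero_ereal_def)

lemma has_fps_expansion_imp_eventually_sums:
  assumes "f has_fps_expansion F"
  shows "\<forall>\<^sub>F t in nhds 0. (\<lambda>n. fps_nth F n * t ^ n) sums f t"
proof -
  have "\<forall>\<^sub>F t in nhds 0. eval_fps F t = f t"
    using assms by (simp add: has_fps_expansion_def)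
  with has_fps_expansion_imp_eventually_in_eball[OF assms] show ?thesis
  proof eventually_elim
    case (elim t)
    then show ?case
      using sums_eval_fps[of t F] by simp
  qed
qed

lemma has_fps_expansion_imp_tendsto_nhds:
  fixes F :: "'a :: {banach, real_normed_field} fps"
  assumes "f has_fps_expansion F"
  shows "(f \<longlongrightarrow> fps_nth F 0) (nhds 0)"
  using has_fps_expansion_imp_continuous[OF assms, of UNIV]
    has_fps_expansion_imp_0_eq_fps_nth_0[OF assms] tendsto_at_iff_tendsto_nhds[of f 0]
  by (simp add: continuous_at)

definition fps_of_real :: "real fps \<Rightarrow> complex fps"
  where "fps_of_real F = Abs_fps (\<lambda>n. of_real (fps_nth F n))"

lemma fps_nth_fps_of_real [simp]: "fps_nth (fps_of_real F) n = of_real (fps_nth F n)"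
  by (simp add: fps_of_real_def)

lemma fps_of_real_power: "fps_of_real (F ^ k) = fps_of_real F ^ k"
proof (induction k)
  case 0
  show ?case
    by (simp add: fps_eq_iff)
next
  case (Suc k)
  have "fps_of_real (F * F ^ k) = fps_of_real F * fps_of_real (F ^ k)"
    by (simp add: fps_eq_iff fps_mult_nth)
  with Suc show ?case
    by simp
qed

lemma fps_of_real_compose: "fps_of_real (F oo G) = fps_of_real F oo fps_of_real G"
  by (simp add: fps_eq_iff fps_compose_nth flip: fps_of_real_power)

lemma fps_conv_radius_fps_of_real [simp]: "fps_conv_radius (fps_of_real F) = fps_conv_radius F"
proof -
  have "conv_radius (\<lambda>n. norm (fps_nth (fps_of_real F) n)) = conv_radius (\<lambda>n. norm (fps_nth F n))"
    by simp
  then show ?thesis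
    unfolding fps_conv_radius_def conv_radius_norm .
qed

lemma eval_fps_fps_of_real:
  assumes "t \<in> eball 0 (fps_conv_radius F)"
  shows "eval_fps (fps_of_real F) (of_real t) = of_real (eval_fps F t)"
proof -
  have "(\<lambda>n. complex_of_real (fps_nth F n * t ^ n)) sums of_real (eval_fps F t)"
    using assms by (intro sums_of_real sums_eval_fps) simp
  then show ?thesis
    by (simp add: eval_fps_def sums_iff)
qed

lemma has_fps_expansion_imp_eventually_eval_fps_of_real:
  assumes "f has_fps_expansion F"
  shows "\<forall>\<^sub>F t in nhds 0. eval_fps (fps_of_real F) (of_real t) = of_real (f t)"
proof -
  have "\<forall>\<^sub>F t in nhds 0. eval_fps F t = f t"
    using assms by (simp add: has_fps_expansion_def)
  with has_fps_expansion_imp_eventually_in_eball[OF assms] show ?thesis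
    by eventually_elim (simp add: eval_fps_fps_of_real)
qed

lemma has_fps_expansion_of_real_imp_real:
  assumes f': "f' has_fps_expansion fps_of_real F"
    and extends: "\<forall>\<^sub>F t in nhds 0. f' (of_real t) = of_real (f t)"
  shows "f has_fps_expansion F"
proof (rule has_fps_expansionI)
  have "filterlim complex_of_real (nhds 0) (nhds 0)"
    using tendsto_of_real[OF filterlim_ident, of "0::real"] by simp
  from eventually_compose_filterlim[OF has_fps_expansion_imp_eventually_sums[OF f'] this] extends
  show "\<forall>\<^sub>F t in nhds 0. (\<lambda>n. fps_nth F n * t ^ n) sums f t"
  proof eventually_elim
    case (elim t)
    then have "(\<lambda>n. complex_of_real (fps_nth F n * t ^ n)) sums of_real (f t)"
      by simp
    then show ?case
      by (simp only: sums_of_real_iff)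
  qed
qed

lemma has_fps_expansion_compose_real:
  fixes f g :: "real \<Rightarrow> real"
  assumes f: "f has_fps_expansion F" and g: "g has_fps_expansion G"
    and G0: "fps_nth G 0 = 0"
  shows "(f \<circ> g) has_fps_expansion (F oo G)"
proof (rule has_fps_expansion_of_real_imp_real)
  define f' g' where "f' = eval_fps (fps_of_real F)" and "g' = eval_fps (fps_of_real G)"
  have "f' has_fps_expansion fps_of_real F" "g' has_fps_expansion fps_of_real G"
    using f g unfolding f'_def g'_def
    by (auto intro!: eval_fps_has_fps_expansion simp: has_fps_expansion_def)
  then show "(f' \<circ> g') has_fps_expansion fps_of_real (F oo G)"
    unfolding fps_of_real_compose using G0 by (intro has_fps_expansion_compose) auto
  have "(g \<longlongrightarrow> 0) (nhds 0)"
    using has_fps_expansion_imp_tendsto_nhds[OF g] G0 by simp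
  with has_fps_expansion_imp_eventually_eval_fps_of_real[OF f]
  have "\<forall>\<^sub>F t in nhds 0. f' (of_real (g t)) = of_real (f (g t))"
    unfolding f'_def by (rule eventually_compose_filterlim)
  moreover have "\<forall>\<^sub>F t in nhds 0. g' (of_real t) = of_real (g t)"
    unfolding g'_def using g by (rule has_fps_expansion_imp_eventually_eval_fps_of_real)
  ultimately show "\<forall>\<^sub>F t in nhds 0. (f' \<circ> g') (of_real t) = of_real ((f \<circ> g) t)"
    by eventually_elim simp
qed

lemma pochhammer_series_sums:
  fixes y t :: real
  assumes "\<bar>t\<bar> < 1"
  shows "(\<lambda>n. pochhammer y n / fact n * t ^ n) sums ((1 / (1 - t)) powr y)"
proof -
  have "(- y gchoose n) * (- t) ^ n = pochhammer y n / fact n * t ^ n" for n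
  proof -
    have "(- 1) ^ n * (- t) ^ n = t ^ n"
      by (simp flip: power_mult_distrib)
    then show ?thesis
      by (simp add: gbinomial_pochhammer mult_ac)
  qed
  moreover have "(1 + - t) powr (- y) = (1 / (1 - t)) powr y"
    using assms by (simp add: powr_minus powr_divide inverse_eq_divide)
  ultimately show ?thesis
    using gen_binomial_real[of "- t" "- y"] assms by simp
qed

lemma abs_pochhammer_le:
  fixes y :: "'a :: linordered_idom"
  shows "\<bar>pochhammer y n\<bar> \<le> pochhammer \<bar>y\<bar> n"
proof (induction n)
  case (Suc n)
  have "\<bar>y + of_nat n\<bar> \<le> \<bar>y\<bar> + of_nat n"
    using abs_triangle_ineq[of y "of_nat n"] by simp
  with Suc show ?case
    unfolding pochhammer_Suc abs_mult by (intro mult_mono) (auto intro: order_trans[OF abs_ge_zero])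
qed simp

lemma sum_abs_pochhammer_series_le:
  fixes y t :: real
  assumes "\<bar>t\<bar> < 1"
  shows "(\<Sum>n<N. \<bar>pochhammer y n / fact n * t ^ n\<bar>) \<le> (1 / (1 - \<bar>t\<bar>)) powr \<bar>y\<bar>"
proof -
  define b where "b n = pochhammer \<bar>y\<bar> n / fact n * \<bar>t\<bar> ^ n" for n
  have a_le_b: "\<bar>pochhammer y n / fact n * t ^ n\<bar> \<le> b n" for n
    by (auto simp: b_def abs_mult power_abs abs_pochhammer_le
        intro!: mult_right_mono divide_right_mono)
  have b_sums: "b sums ((1 / (1 - \<bar>t\<bar>)) powr \<bar>y\<bar>)"
    unfolding b_def using assms by (intro pochhammer_series_sums) simp
  have "(\<Sum>n<N. \<bar>pochhammer y n / fact n * t ^ n\<bar>) \<le> (\<Sum>n<N. b n)"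
    by (intro sum_mono a_le_b)
  also have "\<dots> \<le> suminf b"
    using b_sums by (intro sum_le_suminf sums_summable order_trans[OF abs_ge_zero a_le_b]) auto
  also have "\<dots> = (1 / (1 - \<bar>t\<bar>)) powr \<bar>y\<bar>"
    using b_sums by (rule sums_unique[symmetric])
  finally show ?thesis .
qed

lemma sums_integral_dominated:
  fixes f :: "nat \<Rightarrow> 'a \<Rightarrow> 'b :: {banach, second_countable_topology}"
  assumes f[measurable]: "\<And>n. f n \<in> borel_measurable M" and g: "g \<in> borel_measurable M"
    and w: "integrable M w"
    and sums: "AE x in M. (\<lambda>n. f n x) sums g x"
    and bound: "\<And>N. AE x in M. (\<Sum>n<N. norm (f n x)) \<le> w x"
  shows "(\<lambda>n. integral\<^sup>L M (f n)) sums integral\<^sup>L M g"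
proof -
  have "integrable M (f n)" for n
  proof (rule Bochner_Integration.integrable_bound[OF w f])
    show "AE x in M. norm (f n x) \<le> norm (w x)"
      using bound[of "Suc n"]
    proof eventually_elim
      case (elim x)
      have "norm (f n x) \<le> (\<Sum>k<Suc n. norm (f k x))"
        by (simp add: sum_nonneg)
      with elim show ?case
        by simp
    qed
  qed
  then have integral_sum: "(\<integral>x. (\<Sum>n<N. f n x) \<partial>M) = (\<Sum>n<N. integral\<^sup>L M (f n))" for N
    by (intro Bochner_Integration.integral_sum)
  have "(\<lambda>N. \<integral>x. (\<Sum>n<N. f n x) \<partial>M) \<longlonglongrightarrow> integral\<^sup>L M g"
  proof (rule integral_dominated_convergence[OF g _ w])
    show "AE x in M. (\<lambda>N. \<Sum>n<N. f n x) \<longlonglongrightarrow> g x"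
      using sums by (simp add: sums_def)
    show "AE x in M. norm (\<Sum>n<N. f n x) \<le> w x" for N
      using bound[of N] by eventually_elim (rule order_trans[OF norm_sum])
  qed measurable
  then show ?thesis
    by (simp add: sums_def integral_sum)
qed

lemma integrable_exp_abs:
  fixes Y :: "'a \<Rightarrow> real"
  assumes [measurable]: "Y \<in> borel_measurable M"
    and "integrable M (\<lambda>\<omega>. exp (c * Y \<omega>))" "integrable M (\<lambda>\<omega>. exp (- c * Y \<omega>))"
  shows "integrable M (\<lambda>\<omega>. exp (c * \<bar>Y \<omega>\<bar>))"
proof (rule Bochner_Integration.integrable_bound)
  show "integrable M (\<lambda>\<omega>. exp (c * Y \<omega>) + exp (- c * Y \<omega>))"
    using assms by (intro Bochner_Integration.integrable_add)
  have "exp (c * \<bar>y\<bar>) \<le> \<bar>exp (c * y) + exp (- c * y)\<bar>" for y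
    by (cases "y \<ge> 0") (simp_all add: abs_of_nonneg[OF add_nonneg_nonneg])
  then show "AE \<omega> in M. norm (exp (c * \<bar>Y \<omega>\<bar>)) \<le> norm (exp (c * Y \<omega>) + exp (- c * Y \<omega>))"
    by simp
qed simp

definition lah_gen_fps :: "'a measure \<Rightarrow> ('a \<Rightarrow> real) \<Rightarrow> real fps"
  where "lah_gen_fps M Y = Abs_fps (\<lambda>n. (\<integral>\<omega>. pochhammer (Y \<omega>) n \<partial>M) / fact n)"

lemma lah_gen_sums:
  fixes Y :: "'a \<Rightarrow> real" and t :: real
  assumes [measurable]: "Y \<in> borel_measurable M"
    and t: "\<bar>t\<bar> < 1"
    and int: "integrable M (\<lambda>\<omega>. (1 / (1 - \<bar>t\<bar>)) powr \<bar>Y \<omega>\<bar>)"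
  shows "(\<lambda>n. fps_nth (lah_gen_fps M Y) n * t ^ n) sums lah_gen M Y t"
proof -
  have [measurable]: "(\<lambda>\<omega>. pochhammer (Y \<omega>) n) \<in> borel_measurable M" for n
    by (simp add: pochhammer_prod)
  have "(\<lambda>n. \<integral>\<omega>. pochhammer (Y \<omega>) n / fact n * t ^ n \<partial>M) sums lah_gen M Y t"
    unfolding lah_gen_def
  proof (rule sums_integral_dominated[OF _ _ int])
    show "AE \<omega> in M. (\<Sum>n<N. norm (pochhammer (Y \<omega>) n / fact n * t ^ n))
        \<le> (1 / (1 - \<bar>t\<bar>)) powr \<bar>Y \<omega>\<bar>" for N
      using sum_abs_pochhammer_series_le[OF t] by simp
  qed (use pochhammer_series_sums[OF t] in auto)
  then show ?thesis
    by (simp add: lah_gen_fps_def)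
qed

lemma lah_gen_has_fps_expansion:
  fixes Y :: "'a \<Rightarrow> real" and r :: real
  assumes Y: "Y \<in> borel_measurable M"
    and "r > 0"
    and int: "\<And>t. \<bar>t\<bar> < r \<Longrightarrow> integrable M (\<lambda>\<omega>. exp (t * Y \<omega>))"
  shows "lah_gen M Y has_fps_expansion lah_gen_fps M Y"
proof (rule has_fps_expansionI)
  have "integrable M (\<lambda>\<omega>. exp (t * \<bar>Y \<omega>\<bar>))" if "\<bar>t\<bar> < r" for t
    using that by (intro integrable_exp_abs Y int) auto
  with \<open>r > 0\<close> have "\<forall>\<^sub>F t in nhds 0. integrable M (\<lambda>\<omega>. (1 / (1 - t)) powr \<bar>Y \<omega>\<bar>)"
    by (rule lah_gen_integrable)
  moreover have "filterlim (\<lambda>t::real. \<bar>t\<bar>) (nhds 0) (nhds 0)"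
    using tendsto_rabs[OF filterlim_ident, of "0::real"] by simp
  ultimately have "\<forall>\<^sub>F t::real in nhds 0. integrable M (\<lambda>\<omega>. (1 / (1 - \<bar>t\<bar>)) powr \<bar>Y \<omega>\<bar>)"
    by (rule eventually_compose_filterlim)
  moreover have "\<forall>\<^sub>F t::real in nhds 0. t \<in> {-1<..<1}"
    by (intro eventually_nhds_in_open) auto
  ultimately show "\<forall>\<^sub>F t in nhds 0. (\<lambda>n. fps_nth (lah_gen_fps M Y) n * t ^ n) sums lah_gen M Y t"
    by eventually_elim (auto intro: lah_gen_sums[OF Y])
qed

lemma (in prob_space) fps_nth_lah_gen_fps_0 [simp]: "fps_nth (lah_gen_fps M Y) 0 = 1"
  by (simp add: lah_gen_fps_def prob_space)

lemma prob_lah_eq_fps_nth: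
  assumes "lah_gen M Y has_fps_expansion F"
  shows "prob_lah M Y n k = fact n * (fps_nth ((F - 1) ^ k) n / fact k)"
proof -
  have "(\<lambda>t. 1 / fact k * (lah_gen M Y t - 1) ^ k) has_fps_expansion
      fps_const (1 / fact k) * (F - 1) ^ k"
    by (intro fps_expansion_intros assms)
  then have "(THE G. (\<lambda>t. 1 / fact k * (lah_gen M Y t - 1) ^ k) has_fps_expansion G) =
      fps_const (1 / fact k) * (F - 1) ^ k"
    by (intro the_equality) (auto intro: has_fps_expansion_unique)
  then show ?thesis
    by (simp add: prob_lah_def)
qed

lemma prob_lah_bell_eq_fps_nth:
  assumes "lah_gen M Y has_fps_expansion F"
  shows "prob_lah_bell M Y n x = fact n * fps_nth (fps_exp x oo (F - 1)) n"
  by (simp add: prob_lah_bell_def prob_lah_eq_fps_nth[OF assms] fps_compose_nth sum_distrib_left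
      mult_ac)

theorem theorem2p3:
  fixes M :: "'a measure" and Y :: "'a \<Rightarrow> real" and r x :: real
  assumes "prob_space M"
    and "Y \<in> borel_measurable M"
    and "r > 0"
    and "\<And>t. \<bar>t\<bar> < r \<Longrightarrow> integrable M (\<lambda>\<omega>. exp (t * Y \<omega>))"
  shows "\<forall>\<^sub>F t in nhds 0.
    (\<lambda>n. prob_lah_bell M Y n x * t ^ n / fact n) sums exp (x * (lah_gen M Y t - 1))"
proof -
  interpret prob_space M by fact
  have lah: "lah_gen M Y has_fps_expansion lah_gen_fps M Y"
    using assms(2-4) by (rule lah_gen_has_fps_expansion)
  then have "(\<lambda>t. lah_gen M Y t - 1) has_fps_expansion (lah_gen_fps M Y - 1)"
    by (intro fps_expansion_intros)
  then have "((\<lambda>y. exp (x * y)) \<circ> (\<lambda>t. lah_gen M Y t - 1)) has_fps_expansion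
      (fps_exp x oo (lah_gen_fps M Y - 1))"
    by (intro has_fps_expansion_compose_real has_fps_expansion_exp) simp_all
  from has_fps_expansion_imp_eventually_sums[OF this] show ?thesis
    by (simp add: prob_lah_bell_eq_fps_nth[OF lah])
qed

end
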